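(* Let $(\{A_\alpha\}_{\alpha\in\Omega},\{\Psi_\alpha\}_{\alpha\in\Omega})$ be a continuous operator-valued frame in $\mathcal{B}(\mathcal{H},\mathcal{H}_0)$. Suppose $\{B_\alpha\}_{\alpha\in\Omega}$ in $\mathcal{B}(\mathcal{H},\mathcal{H}_0)$ is such that (i) $\Psi_\alpha^*B_\alpha\ge0$ for all $\alpha\in\Omega$; (ii) for each $h\in\mathcal{H}$, the map $\Omega\ni\alpha\mapsto B_\alpha h\in\mathcal{H}_0$ is measurable; (iii) there exist real numbers $\kappa,\beta,\gamma\ge0$ with $\max\{\kappa+\gamma\|\theta_\Psi S_{A,\Psi}^{-1}\|,\beta\}<1$ such that for all $f\in\mathcal{L}^2(\Omega,\mathcal{H}_0)$ $$\left\|\int_\Omega(A_\alpha^*-B_\alpha^* )f(\alpha)\,d\mu(\alpha)\right\|\le\kappa\left\|\int_\Omega A_\alpha^*f(\alpha)\,d\mu(\alpha)\right\|+\beta\left\|\int_\Omega B_\alpha^*f(\alpha)\,d\mu(\alpha)\right\|+\gamma\|f\|.$$ Then $(\{B_\alpha\}_{\alpha\in\Omega},\{\Psi_\alpha\}_{\alpha\in\Omega})$ is a continuous operator-valued frame with bounds $$\frac{1-(\kappa+\gamma\|\theta_\Psi S_{A,\Psi}^{-1}\|)}{(1+\beta)\|S_{A,\Psi}^{-1}\|}\quad\text{and}\quad\frac{\|\theta_\Psi\|((1+\kappa)\|\theta_A\|+\gamma)}{1-\beta}.$$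
   Context: $\mathcal{H},\mathcal{H}_0$ are Hilbert spaces over $\mathbb{K}\in\{\mathbb{R},\mathbb{C}\}$; $\mathcal{B}(\mathcal{H},\mathcal{H}_0)$ denotes bounded linear operators; $(\Omega,\mu)$ is a measure space with positive measure. All vector-valued integrals are weak: $\int_\Omega F\,d\mu$ is the element of $\mathcal{H}$ with $\langle\int_\Omega F\,d\mu,g\rangle=\int_\Omega\langle F(\alpha),g\rangle\,d\mu(\alpha)$ for all $g\in\mathcal{H}$; condition (iii) includes that the integrals in it exist in this sense. A collection $\{A_\alpha\}_{\alpha\in\Omega}$ in $\mathcal{B}(\mathcal{H},\mathcal{H}_0)$ is a continuous operator-valued frame with respect to $\{\Psi_\alpha\}_{\alpha\in\Omega}$ in $\mathcal{B}(\mathcal{H},\mathcal{H}_0)$ (one says $(\{A_\alpha\}_{\alpha\in\Omega},\{\Psi_\alpha\}_{\alpha\in\Omega})$ is a continuous operator-valued frame) if: (1) for each $h\in\mathcal{H}$ the maps $\alpha\mapsto A_\alpha h$ and $\alpha\mapsto\Psi_\alpha h$ are measurable; (2) the frame operator $S_{A,\Psi}:\mathcal{H}\ni h\mapsto\int_\Omega\Psi_\alpha^*A_\alpha h\,d\mu(\alpha)\in\mathcal{H}$ is a well-defined bounded positive invertible operator; (3) the analysis operators $\theta_A,\theta_\Psi:\mathcal{H}\to\mathcal{L}^2(\Omega,\mathcal{H}_0)$, $(\theta_Ah)(\alpha)=A_\alpha h$, $(\theta_\Psi h)(\alpha)=\Psi_\alpha h$, are well-defined bounded linear operators (with adjoint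 $\theta_A^*f=\int_\Omega A_\alpha^*f(\alpha)\,d\mu(\alpha)$). Bounds $a,b>0$ of a frame mean $a\|h\|^2\le\langle S_{A,\Psi}h,h\rangle\le b\|h\|^2$ for all $h\in\mathcal{H}$.
   Formalization: The measure μ is additionally assumed semifinite (every set of infinite measure contains a subset of finite positive measure); otherwise θ_B may fail to map into L², e.g. μ{0}=1, μ{1}=∞, A=Ψ=(1,0), B=(1,1). *)

theory Defs
  imports "HOL-Analysis.Analysis"
begin

(* The scalar field K.  The second axiom says that z \<bullet> 1 is the real part of z.  By the two
   axioms every z is a root of the real polynomial X^2 - 2 (z \<bullet> 1) X + (norm z)^2, so the
   real and the complex numbers are the only models, up to isomorphism. *)
class real_or_complex = real_normed_field + euclidean_space +
  fixes conj :: "'a \<Rightarrow> 'a"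
  assumes mult_conj: "z * conj z = (norm z)\<^sup>2 *\<^sub>R 1"
    and add_conj: "z + conj z = (2 * (z \<bullet> 1)) *\<^sub>R 1"

instantiation real :: real_or_complex
begin
definition conj_real :: "real \<Rightarrow> real" where "conj_real z = z"
instance by standard (simp_all add: conj_real_def power2_eq_square)
end

instantiation complex :: real_or_complex
begin
definition conj_complex :: "complex \<Rightarrow> complex" where "conj_complex z = cnj z"
instance
  by standard (simp_all add: conj_complex_def complex_norm_square[symmetric] complex_add_cnj
      inner_complex_def complex_eq_iff cmod_power2 power2_eq_square)
end

definition re_part :: "'k::real_or_complex \<Rightarrow> real" where
  "re_part z = z \<bullet> 1"

(* Hilbert space over K: completeness is the class banach of the carrier type, whose norm is the
   one given by the inner product ip, linear in the first argument. *)
locale hilbert_space_over = vector_space scl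
  for scl :: "'k::real_or_complex \<Rightarrow> 'h::banach \<Rightarrow> 'h" +
  fixes ip :: "'h \<Rightarrow> 'h \<Rightarrow> 'k"
  assumes scale_of_real: "scl (of_real r) x = r *\<^sub>R x"
    and ip_add_left: "ip (x + y) z = ip x z + ip y z"
    and ip_scale_left: "ip (scl c x) y = c * ip x y"
    and ip_conj: "ip y x = conj (ip x y)"
    and ip_self: "ip x x = of_real ((norm x)\<^sup>2)"

lemma hilbert_space_over_real:
  "hilbert_space_over scaleR (inner :: 'h::{real_inner,banach} \<Rightarrow> 'h \<Rightarrow> real)"
  by unfold_locales
    (simp_all add: conj_real_def inner_add_left inner_commute power2_norm_eq_inner algebra_simps)

lemma hilbert_space_over_complex:
  "hilbert_space_over ((*) :: complex \<Rightarrow> complex \<Rightarrow> complex) (\<lambda>x y. x * cnj y)"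
  by unfold_locales
    (simp_all add: conj_complex_def algebra_simps complex_norm_square[symmetric] scaleR_conv_of_real)

definition bounded_operator ::
  "('k::real_or_complex \<Rightarrow> 'h::banach \<Rightarrow> 'h) \<Rightarrow> ('k \<Rightarrow> 'g::banach \<Rightarrow> 'g) \<Rightarrow> ('h \<Rightarrow> 'g) \<Rightarrow> bool" where
  "bounded_operator scl scl' T \<longleftrightarrow>
     bounded_linear T \<and> (\<forall>c x. T (scl c x) = scl' c (T x))"

definition adjoint_op ::
  "('h \<Rightarrow> 'h \<Rightarrow> 'k) \<Rightarrow> ('g \<Rightarrow> 'g \<Rightarrow> 'k) \<Rightarrow> ('h \<Rightarrow> 'g) \<Rightarrow> 'g \<Rightarrow> 'h" where
  "adjoint_op ip ip' T = (THE T'. \<forall>x y. ip' (T x) y = ip x (T' y))"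

(* Self-adjointness is automatic over the complex numbers but not over the reals. *)
definition positive_operator :: "('h \<Rightarrow> 'h \<Rightarrow> 'k::real_or_complex) \<Rightarrow> ('h \<Rightarrow> 'h) \<Rightarrow> bool" where
  "positive_operator ip T \<longleftrightarrow>
     (\<forall>x y. ip (T x) y = ip x (T y)) \<and> (\<forall>x. 0 \<le> re_part (ip (T x) x))"

definition invertible_operator ::
  "('k::real_or_complex \<Rightarrow> 'h::banach \<Rightarrow> 'h) \<Rightarrow> ('h \<Rightarrow> 'h) \<Rightarrow> bool" where
  "invertible_operator scl T \<longleftrightarrow>
     bounded_operator scl scl T \<and> bij T \<and> bounded_operator scl scl (inv T)"

definition has_weak_integral ::
  "('h \<Rightarrow> 'h \<Rightarrow> 'k::real_or_complex) \<Rightarrow> 'a measure \<Rightarrow> ('a \<Rightarrow> 'h) \<Rightarrow> 'h \<Rightarrow> bool" where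
  "has_weak_integral ip M F v \<longleftrightarrow>
     (\<forall>g. integrable M (\<lambda>\<alpha>. ip (F \<alpha>) g) \<and> ip v g = (LINT \<alpha>|M. ip (F \<alpha>) g))"

definition weakly_integrable ::
  "('h \<Rightarrow> 'h \<Rightarrow> 'k::real_or_complex) \<Rightarrow> 'a measure \<Rightarrow> ('a \<Rightarrow> 'h) \<Rightarrow> bool" where
  "weakly_integrable ip M F \<longleftrightarrow> (\<exists>v. has_weak_integral ip M F v)"

definition weak_integral ::
  "('h \<Rightarrow> 'h \<Rightarrow> 'k::real_or_complex) \<Rightarrow> 'a measure \<Rightarrow> ('a \<Rightarrow> 'h) \<Rightarrow> 'h" where
  "weak_integral ip M F = (THE v. has_weak_integral ip M F v)"

(* Measurability in the sense of Bochner.  Without separability of the range, sums of measurable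
   functions into a nonseparable space need not be measurable, and L2 below would not be a
   vector space. *)
definition strongly_measurable :: "'a measure \<Rightarrow> ('a \<Rightarrow> 'g::banach) \<Rightarrow> bool" where
  "strongly_measurable M f \<longleftrightarrow>
     f \<in> borel_measurable M \<and> (\<exists>D. countable D \<and> f ` space M \<subseteq> closure D)"

lemma strongly_measurable_iff_borel_measurable:
  fixes f :: "'a \<Rightarrow> 'g::{banach,second_countable_topology}"
  shows "strongly_measurable M f \<longleftrightarrow> f \<in> borel_measurable M"
proof -
  obtain D :: "'g set" where "countable D" "UNIV \<subseteq> closure D"
    using separable[of "UNIV :: 'g set"] by auto
  then show ?thesis
    unfolding strongly_measurable_def by blast
qed

(* Functions rather than classes of functions modulo equality almost everywhere. *)
definition L2 :: "'a measure \<Rightarrow> ('a \<Rightarrow> 'g::banach) set" where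
  "L2 M = {f. strongly_measurable M f \<and> integrable M (\<lambda>\<alpha>. (norm (f \<alpha>))\<^sup>2)}"

definition L2_norm :: "'a measure \<Rightarrow> ('a \<Rightarrow> 'g::banach) \<Rightarrow> real" where
  "L2_norm M f = sqrt (LINT \<alpha>|M. (norm (f \<alpha>))\<^sup>2)"

(* The analogue of onorm, which is the least C with L2_norm M (T h) \<le> C * norm h, for operators into L2 M. *)
definition onorm_L2 :: "'a measure \<Rightarrow> ('h::banach \<Rightarrow> 'a \<Rightarrow> 'g::banach) \<Rightarrow> real" where
  "onorm_L2 M T = (SUP h. L2_norm M (T h) / norm h)"

definition analysis_op :: "('a \<Rightarrow> 'h \<Rightarrow> 'g) \<Rightarrow> 'h \<Rightarrow> 'a \<Rightarrow> 'g" where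
  "analysis_op A h = (\<lambda>\<alpha>. A \<alpha> h)"

(* Linearity is not required here since it is inherited pointwise from the operators A \<alpha>. *)
definition analysis_op_bounded :: "'a measure \<Rightarrow> ('a \<Rightarrow> 'h::banach \<Rightarrow> 'g::banach) \<Rightarrow> bool" where
  "analysis_op_bounded M A \<longleftrightarrow>
     (\<forall>h. analysis_op A h \<in> L2 M) \<and> (\<exists>C. \<forall>h. L2_norm M (analysis_op A h) \<le> C * norm h)"

definition frame_op ::
  "('h \<Rightarrow> 'h \<Rightarrow> 'k::real_or_complex) \<Rightarrow> ('g \<Rightarrow> 'g \<Rightarrow> 'k) \<Rightarrow> 'a measure \<Rightarrow>
   ('a \<Rightarrow> 'h \<Rightarrow> 'g) \<Rightarrow> ('a \<Rightarrow> 'h \<Rightarrow> 'g) \<Rightarrow> 'h \<Rightarrow> 'h" where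
  "frame_op ip ip' M A \<Psi> h = weak_integral ip M (\<lambda>\<alpha>. adjoint_op ip ip' (\<Psi> \<alpha>) (A \<alpha> h))"

definition continuous_ovf ::
  "('k::real_or_complex \<Rightarrow> 'h::banach \<Rightarrow> 'h) \<Rightarrow> ('h \<Rightarrow> 'h \<Rightarrow> 'k) \<Rightarrow>
   ('k \<Rightarrow> 'g::banach \<Rightarrow> 'g) \<Rightarrow> ('g \<Rightarrow> 'g \<Rightarrow> 'k) \<Rightarrow> 'a measure \<Rightarrow>
   ('a \<Rightarrow> 'h \<Rightarrow> 'g) \<Rightarrow> ('a \<Rightarrow> 'h \<Rightarrow> 'g) \<Rightarrow> bool" where
  "continuous_ovf scl ip scl' ip' M A \<Psi> \<longleftrightarrow>
     (\<forall>\<alpha>\<in>space M. bounded_operator scl scl' (A \<alpha>) \<and> bounded_operator scl scl' (\<Psi> \<alpha>)) \<and>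
     (\<forall>h. strongly_measurable M (\<lambda>\<alpha>. A \<alpha> h) \<and> strongly_measurable M (\<lambda>\<alpha>. \<Psi> \<alpha> h)) \<and>
     (\<forall>h. weakly_integrable ip M (\<lambda>\<alpha>. adjoint_op ip ip' (\<Psi> \<alpha>) (A \<alpha> h))) \<and>
     bounded_operator scl scl (frame_op ip ip' M A \<Psi>) \<and>
     positive_operator ip (frame_op ip ip' M A \<Psi>) \<and>
     invertible_operator scl (frame_op ip ip' M A \<Psi>) \<and>
     analysis_op_bounded M A \<and> analysis_op_bounded M \<Psi>"

definition frame_bounds ::
  "('h::banach \<Rightarrow> 'h \<Rightarrow> 'k::real_or_complex) \<Rightarrow> ('g \<Rightarrow> 'g \<Rightarrow> 'k) \<Rightarrow> 'a measure \<Rightarrow>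
   ('a \<Rightarrow> 'h \<Rightarrow> 'g) \<Rightarrow> ('a \<Rightarrow> 'h \<Rightarrow> 'g) \<Rightarrow> real \<Rightarrow> real \<Rightarrow> bool" where
  "frame_bounds ip ip' M A \<Psi> a b \<longleftrightarrow> 0 < a \<and> 0 < b \<and>
     (\<forall>h. a * (norm h)\<^sup>2 \<le> re_part (ip (frame_op ip ip' M A \<Psi> h) h) \<and>
          re_part (ip (frame_op ip ip' M A \<Psi> h) h) \<le> b * (norm h)\<^sup>2)"

(* Every measurable set of infinite measure has a measurable subset of finite positive measure.
   Functions in L2 M vanish almost everywhere on a set without this property, so that a condition
   quantified over L2 M does not constrain a family of operators there.  Example: measures 1 and
   \<infinity> on the points 0 and 1, all Hilbert spaces K, A = \<Psi> = (1, 0) and B = (1, 1); then B does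
   not map into L2 M, although A and B cannot be told apart by integrals against functions in L2 M.
   Sigma-finite measures and all counting measures satisfy the property.  The library's
   semifinite_measure omits the positivity and is satisfied by every measure. *)
definition semi_finite_measure :: "'a measure \<Rightarrow> bool" where
  "semi_finite_measure M \<longleftrightarrow>
     (\<forall>E\<in>sets M. emeasure M E = \<infinity> \<longrightarrow>
        (\<exists>F\<in>sets M. F \<subseteq> E \<and> 0 < emeasure M F \<and> emeasure M F < \<infinity>))"

end

(* With theta_B f = (alpha |-> B_alpha f), the positivity of Psi_alpha^* B_alpha gives
   S_B = theta_B^* theta_Psi, and (iii) bounds theta_B^*; semifiniteness of the measure then puts
   B h into L2.  Applied to f = theta_Psi S^{-1} k, for which theta_A^* f = k, condition (iii)
   bounds S_B S^{-1} below.  A positive operator that is bounded below is coercive, hence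
   invertible by a minimisation argument, and Cauchy-Schwarz for the form <S_B x, y> turns
   norm h <= K norm (S_B h) into (norm h)^2 <= K <S_B h, h>, which is the lower frame bound. *)
theory Submission
  imports Defs
begin

text \<open>Condition (iii) speaks only of theta_A^* and theta_B^*, whereas frame operators have the
  shape theta_Psi^* theta_A. Self-adjointness exchanges the factors, so that (iii) can be tested on
  theta_Psi h, which is square integrable from the start; theta_B h is not yet known to be. Since
  beta < 1, the term with theta_B^* on the right of (iii) can be absorbed on the left, whence the
  factor 1 / (1 - beta).

  The estimate of norm h by norm (S_B h) is used twice. Coercivity obtained through the operator
  norm of S_B has a poor constant, good enough only for inverting S_B. The sharp frame bound comes
  afterwards, from Cauchy-Schwarz for the pair h, S_B^{-1} h, once the inverse exists.

  To cover both scalar fields at once, the variational argument works with real parts. The same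
  minimisation yields the Riesz representation, and with it the adjoints, because a linear
  functional is determined by its real part.\<close>

section \<open>Conjugation and real part in the scalar field\<close>

lemma inner_one_one [simp]: "(1::'k::real_or_complex) \<bullet> 1 = 1"
  by (simp flip: power2_norm_eq_inner)

text \<open>Conjugation is reflection in the real axis. This real-linear formula reduces its
  additive properties and its boundedness to algebra; products and norms are governed by
  \<open>mult_conj\<close>.\<close>

lemma conj_eq: "conj z = (2 * (z \<bullet> 1)) *\<^sub>R 1 - (z::'k::real_or_complex)"
  using add_conj[of z] by (simp add: algebra_simps)

lemma bounded_linear_conj: "bounded_linear (conj :: 'k::real_or_complex \<Rightarrow> 'k)"
  unfolding conj_eq by (intro bounded_linear_intros)

lemma conj_zero [simp]: "conj (0::'k::real_or_complex) = 0"
  by (simp add: conj_eq)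

lemma conj_add: "conj (z + w) = conj z + conj (w::'k::real_or_complex)"
  by (simp add: conj_eq algebra_simps)

lemma conj_conj [simp]: "conj (conj z) = (z::'k::real_or_complex)"
  by (simp add: conj_eq algebra_simps)

lemma conj_of_real [simp]: "conj (of_real r) = (of_real r::'k::real_or_complex)"
  by (simp add: conj_eq of_real_def algebra_simps flip: scaleR_2)

text \<open>Multiplied by \<open>z * w\<close>, both sides become the squared norm of
  \<open>z * w\<close>, and a nonzero factor cancels.\<close>

lemma conj_mult: "conj (z * w) = conj z * conj (w::'k::real_or_complex)"
proof (cases "z = 0 \<or> w = 0")
  case False
  have "(z * w) * conj (z * w) = (z * w) * (conj z * conj w)"
    using mult_conj[of z] mult_conj[of w] mult_conj[of "z * w"]
    by (simp add: norm_mult power_mult_distrib scaleR_conv_of_real algebra_simps)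
  with False show ?thesis by simp
qed auto

lemma norm_conj [simp]: "norm (conj z) = norm (z::'k::real_or_complex)"
proof (cases "z = 0")
  case False
  have "norm z * norm (conj z) = norm z * norm z"
    using arg_cong[OF mult_conj[of z], of norm]
    by (simp add: norm_mult power2_eq_square)
  with False show ?thesis by simp
qed auto

lemma bounded_linear_re_part: "bounded_linear (re_part :: 'k::real_or_complex \<Rightarrow> real)"
  unfolding re_part_def by (rule bounded_linear_inner_left)

lemmas re_part_simps =
  linear_add[OF bounded_linear.linear[OF bounded_linear_re_part]]
  linear_diff[OF bounded_linear.linear[OF bounded_linear_re_part]]
  linear_0[OF bounded_linear.linear[OF bounded_linear_re_part]]
  linear_scale[OF bounded_linear.linear[OF bounded_linear_re_part]]

lemma re_part_of_real [simp]: "re_part (of_real r :: 'k::real_or_complex) = r"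
  by (simp add: re_part_def of_real_def)

lemma re_part_of_real_mult: "re_part (of_real r * z) = r * re_part (z::'k::real_or_complex)"
  by (simp add: re_part_def scaleR_conv_of_real[symmetric])

lemma re_part_conj [simp]: "re_part (conj z) = re_part (z::'k::real_or_complex)"
  by (simp add: re_part_def conj_eq algebra_simps)

lemma re_part_le_norm: "\<bar>re_part z\<bar> \<le> norm (z::'k::real_or_complex)"
  using Cauchy_Schwarz_ineq2[of z 1] by (simp add: re_part_def)

lemma re_part_conj_mult: "re_part (conj z * z) = (norm (z::'k::real_or_complex))\<^sup>2"
  using mult_conj[of z] by (simp add: re_part_def mult.commute)

section \<open>Symmetric real bilinear forms and minimisation\<close>

text \<open>The first-order condition at a minimum: for small t of sign opposite to \<open>b\<close>
  the linear term wins. Any positive d > c makes t = -b/d small enough.\<close>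

lemma quadratic_nonneg_imp_linear_coeff_zero:
  fixes b c :: real
  assumes "\<And>t. 0 \<le> t * b + t\<^sup>2 * c"
  shows "b = 0"
proof (rule ccontr)
  assume "b \<noteq> 0"
  define d where "d = \<bar>c\<bar> + 1"
  have d: "0 < d" "c < d" by (auto simp: d_def)
  have "(- (b / d)) * b + (- (b / d))\<^sup>2 * c = - (b\<^sup>2 / d\<^sup>2) * (d - c)"
    using d by (simp add: field_simps power2_eq_square)
  moreover have "(b\<^sup>2 / d\<^sup>2) * (d - c) > 0" using \<open>b \<noteq> 0\<close> d by simp
  ultimately show False using assms[of "- (b / d)"] by simp
qed

lemma bilinear_simps:
  fixes s :: "'h::real_vector \<Rightarrow> 'h \<Rightarrow> real"
  assumes "bilinear s"
  shows "s (x + y) z = s x z + s y z" "s z (x + y) = s z x + s z y"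
    "s (x - y) z = s x z - s y z" "s z (x - y) = s z x - s z y"
    "s (r *\<^sub>R x) z = r * s x z" "s z (r *\<^sub>R x) = r * s z x"
  using bilinear_ladd[OF assms] bilinear_radd[OF assms] bilinear_lsub[OF assms]
    bilinear_rsub[OF assms] bilinear_lmul[OF assms] bilinear_rmul[OF assms]
  by auto

text \<open>Stated for semidefinite forms because it is applied to <S x, y> before that form is
  known to be definite. If \<open>s y y = 0\<close>, then s(x + t y, x + t y) is affine in t and
  nonnegative, so its slope vanishes; otherwise the projection of \<open>x\<close> along
  \<open>y\<close> is subtracted.\<close>

lemma semidefinite_Cauchy_Schwarz:
  fixes s :: "'h::real_vector \<Rightarrow> 'h \<Rightarrow> real"
  assumes bil: "bilinear s" and sym: "\<And>x y. s x y = s y x" and nonneg: "\<And>x. 0 \<le> s x x"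
  shows "(s x y)\<^sup>2 \<le> s x x * s y y"
proof (cases "s y y = 0")
  case True
  have "0 \<le> t * (2 * s x y) + t\<^sup>2 * 0 + s x x" for t
    using nonneg[of "x + t *\<^sub>R y"] True
    by (simp add: bilinear_simps[OF bil] sym[of y x] algebra_simps power2_eq_square)
  then have *: "0 \<le> t * (2 * s x y) + s x x" for t by simp
  have "s x y = 0"
  proof (rule ccontr)
    assume "s x y \<noteq> 0"
    then show False using *[of "- (s x x + 1) / (2 * s x y)"] by simp
  qed
  then show ?thesis using True by simp
next
  case False
  then have pos: "s y y > 0" using nonneg[of y] by simp
  define t where "t = s x y / s y y"
  have "s (x - t *\<^sub>R y) (x - t *\<^sub>R y) = s x x - 2 * t * s x y + t * t * s y y"
    by (simp add: bilinear_simps[OF bil] sym[of y x] algebra_simps)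
  also have "\<dots> = s x x - (s x y)\<^sup>2 / s y y"
    using pos by (simp add: t_def field_simps power2_eq_square)
  finally have "(s x y)\<^sup>2 / s y y \<le> s x x"
    using nonneg[of "x - t *\<^sub>R y"] by simp
  then show ?thesis using pos by (simp add: field_simps)
qed

text \<open>With the norm as the form this is the Riesz representation theorem.  The solution is the
  minimiser of \<open>J\<close>, and the parallelogram identity makes minimising sequences Cauchy.\<close>

lemma symmetric_Lax_Milgram:
  fixes s :: "'h::banach \<Rightarrow> 'h \<Rightarrow> real"
  assumes bb: "bounded_bilinear s" and sym: "\<And>x y. s x y = s y x"
    and a: "0 < a" "\<And>x. a * (norm x)\<^sup>2 \<le> s x x"
    and phi: "bounded_linear \<phi>"
  obtains x where "\<And>y. s x y = \<phi> y"
proof -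
  have bil: "bilinear s"
    using bb by (auto simp: bilinear_def bounded_bilinear.bounded_linear_left[THEN bounded_linear.linear]
        bounded_bilinear.bounded_linear_right[THEN bounded_linear.linear])
  note s = bilinear_simps[OF bil]
  note f = linear_add[OF bounded_linear.linear[OF phi]] linear_scale[OF bounded_linear.linear[OF phi]]
  \<comment> \<open>Twice the usual energy: the derivative of \<open>J\<close> at x in direction y
    is 2 (s x y - \<phi> y), so a minimiser solves the equation.\<close>
  define J where "J x = s x x - 2 * \<phi> x" for x
  obtain C where C: "\<And>x. norm (\<phi> x) \<le> norm x * C" "C > 0"
    using bounded_linear.pos_bounded[OF phi] by auto
  have below: "- (C\<^sup>2 / a) \<le> J x" for x
  proof -
    have "0 \<le> (a * norm x - C)\<^sup>2 / a" using a by simp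
    also have "\<dots> = a * (norm x)\<^sup>2 - 2 * (norm x * C) + C\<^sup>2 / a"
      using a by (simp add: field_simps power2_eq_square)
    also have "\<dots> \<le> J x + C\<^sup>2 / a"
      using a(2)[of x] C(1)[of x] by (simp add: J_def)
    finally show ?thesis by simp
  qed
  define m where "m = (INF x. J x)"
  have bdd: "bdd_below (range J)" using below by (auto intro!: bdd_belowI)
  have m_le: "m \<le> J x" for x unfolding m_def by (rule cINF_lower[OF bdd]) simp
  have "\<exists>x. J x < m + 1 / real (Suc n)" for n
  proof -
    have "m < m + 1 / real (Suc n)" by simp
    then show ?thesis unfolding m_def by (subst (asm) cINF_less_iff) (use bdd in auto)
  qed
  then obtain X where X: "\<And>n. J (X n) < m + 1 / real (Suc n)" by metis
  \<comment> \<open>The midpoint of \<open>x\<close> and \<open>y\<close> has energy at least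
    \<open>m\<close>, so two points of nearly minimal energy are close together.\<close>
  have par: "a * (norm (x - y))\<^sup>2 \<le> 2 * (J x - m) + 2 * (J y - m)" for x y
  proof -
    have "J x + J y - 2 * J ((1/2) *\<^sub>R (x + y)) = s (x - y) (x - y) / 2"
      by (simp add: J_def s f sym[of y x] algebra_simps)
    then have "s (x - y) (x - y) \<le> 2 * (J x - m) + 2 * (J y - m)"
      using m_le[of "(1/2) *\<^sub>R (x + y)"] by argo
    then show ?thesis using a(2)[of "x - y"] by linarith
  qed
  have "Cauchy X"
  proof (rule metric_CauchyI)
    fix e :: real assume e: "0 < e"
    then have "0 < a * e\<^sup>2 / 4" using a by simp
    \<comment> \<open>Two excesses below 1/N give at most 4/N on the right of \<open>par\<close>,
      hence the 4.\<close>
    then obtain N where N: "N > 0" "1 / real N < a * e\<^sup>2 / 4"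
      using real_arch_inverse by (metis inverse_eq_divide neq0_conv)
    show "\<exists>N. \<forall>i\<ge>N. \<forall>j\<ge>N. dist (X i) (X j) < e"
    proof (intro exI allI impI)
      fix i j assume ij: "i \<ge> N" "j \<ge> N"
      have "1 / real (Suc i) \<le> 1 / real N" "1 / real (Suc j) \<le> 1 / real N"
        using ij N by (auto intro!: divide_left_mono)
      then have "a * (norm (X i - X j))\<^sup>2 < a * e\<^sup>2"
        using par[of "X i" "X j"] X[of i] X[of j] N(2) by argo
      then have "(norm (X i - X j))\<^sup>2 < e\<^sup>2" using a by simp
      then show "dist (X i) (X j) < e" using e by (simp add: dist_norm power_less_imp_less_base)
    qed
  qed
  then obtain x where x: "X \<longlonglongrightarrow> x" using Cauchy_convergent convergent_def by blast
  have "(\<lambda>n. J (X n)) \<longlonglongrightarrow> J x"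
    unfolding J_def
    by (intro tendsto_intros bounded_bilinear.tendsto[OF bb] bounded_linear.tendsto[OF phi] x)
  moreover have "(\<lambda>n. m + 1 / real (Suc n)) \<longlonglongrightarrow> m + 0"
    by (intro tendsto_intros LIMSEQ_Suc lim_1_over_n)
  ultimately have "J x \<le> m"
    using LIMSEQ_le[of "\<lambda>n. J (X n)" "J x" "\<lambda>n. m + 1 / real (Suc n)" "m + 0"] X
    by (simp add: less_imp_le)
  then have min: "J x \<le> J y" for y using m_le[of y] by simp
  have "s x y = \<phi> y" for y
  proof -
    have "0 \<le> t * (2 * (s x y - \<phi> y)) + t\<^sup>2 * s y y" for t
      using min[of "x + t *\<^sub>R y"]
      by (simp add: J_def s f sym[of y x] algebra_simps power2_eq_square)
    from quadratic_nonneg_imp_linear_coeff_zero[OF this] show ?thesis by simp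
  qed
  then show ?thesis using that by blast
qed

section \<open>Hilbert space geometry over either scalar field\<close>

context hilbert_space_over
begin

lemma ip_add_right: "ip x (y + z) = ip x y + ip x z"
  by (metis ip_add_left ip_conj conj_add)

lemma ip_scale_right: "ip x (scl c y) = conj c * ip x y"
  by (metis ip_scale_left ip_conj conj_mult)

lemma ip_scaleR_left: "ip (r *\<^sub>R x) y = of_real r * ip x y"
  by (metis ip_scale_left scale_of_real)

lemma ip_scaleR_right: "ip x (r *\<^sub>R y) = of_real r * ip x y"
  by (metis ip_scale_right scale_of_real conj_of_real)

lemma ip_diff_left: "ip (x - y) z = ip x z - ip y z"
  by (metis add_diff_cancel_right' diff_add_cancel ip_add_left)

text \<open>The locale ties the norm to scalars beyond the reals only through
  \<open>ip_self\<close>, so homogeneity is read off from <c x, c x> = c (conj c) <x, x>.\<close>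

lemma norm_scl: "norm (scl c x) = norm c * norm x"
proof -
  have "(of_real ((norm (scl c x))\<^sup>2) :: 'k) = c * (conj c * of_real ((norm x)\<^sup>2))"
    by (simp only: ip_self[symmetric] ip_scale_left ip_scale_right mult.assoc mult.left_commute)
  also have "\<dots> = of_real ((norm c * norm x)\<^sup>2)"
    using mult_conj[of c]
    by (simp add: mult.assoc[symmetric] power_mult_distrib scaleR_conv_of_real)
  finally have "(norm (scl c x))\<^sup>2 = (norm c * norm x)\<^sup>2"
    by (simp only: of_real_eq_iff)
  then show ?thesis by (simp add: power2_eq_imp_eq)
qed

lemma bilinear_re_ip: "bilinear (\<lambda>x y. re_part (ip x y))"
  by (auto simp: bilinear_def ip_add_left ip_add_right ip_scaleR_left ip_scaleR_right
      re_part_simps re_part_of_real_mult intro!: linearI)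

lemma re_ip_commute: "re_part (ip x y) = re_part (ip y x)"
  by (metis ip_conj re_part_conj)

lemma re_ip_self: "re_part (ip x x) = (norm x)\<^sup>2"
  by (simp only: ip_self re_part_of_real)

lemma re_ip_le: "re_part (ip x y) \<le> norm x * norm y"
proof -
  have "(re_part (ip x y))\<^sup>2 \<le> (norm x * norm y)\<^sup>2"
    using semidefinite_Cauchy_Schwarz[OF bilinear_re_ip re_ip_commute, of x y]
    by (simp add: re_ip_self power_mult_distrib)
  then show ?thesis by (rule power2_le_imp_le) simp
qed

text \<open>Multiplying \<open>x\<close> by the conjugate of \<open>ip x y\<close> makes the inner
  product real, equal to its squared modulus. The bound on real parts then applies, and one factor
  \<open>norm (ip x y)\<close> cancels.\<close>

lemma norm_ip_le: "norm (ip x y) \<le> norm x * norm y"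
proof (cases "ip x y = 0")
  case False
  have "(norm (ip x y))\<^sup>2 \<le> norm (ip x y) * (norm x * norm y)"
    using re_ip_le[of "scl (conj (ip x y)) x" y]
    by (simp add: ip_scale_left re_part_conj_mult norm_scl mult.assoc)
  with False show ?thesis by (simp add: power2_eq_square)
qed simp

lemma bounded_linear_ip_left: "bounded_linear (\<lambda>x. ip x y)"
  by (rule bounded_linear_intro[of _ "norm y"])
    (simp_all add: ip_add_left ip_scaleR_left scaleR_conv_of_real norm_ip_le)

lemma bounded_bilinear_re_ip: "bounded_bilinear (\<lambda>x y. re_part (ip x y))"
proof (rule bounded_bilinear.intro)
  show "\<exists>K. \<forall>a b. norm (re_part (ip a b)) \<le> norm a * norm b * K"
    using order_trans[OF re_part_le_norm norm_ip_le] by (intro exI[of _ 1]) simp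
qed (simp_all add: bilinear_simps[OF bilinear_re_ip])

lemma eq_if_ip_eq:
  assumes "\<And>y. ip x y = ip x' y"
  shows "x = x'"
proof -
  have "ip (x - x') (x - x') = 0" using assms by (simp add: ip_diff_left)
  then have "(norm (x - x'))\<^sup>2 = 0" by (simp only: ip_self of_real_eq_0_iff)
  then show ?thesis by simp
qed

text \<open>Minimisation represents the real part of \<phi>. If d is the remaining discrepancy at
  \<open>x\<close>, evaluating at \<open>scl (conj d) x\<close> turns it into the real number |d|^2,
  which must vanish.\<close>

lemma Riesz_representation:
  assumes bl: "bounded_linear \<phi>" and hom: "\<And>c x. \<phi> (scl c x) = c * \<phi> x"
  obtains v where "\<And>x. \<phi> x = ip x v"
proof -
  obtain v where v: "\<And>x. re_part (ip v x) = re_part (\<phi> x)"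
    using symmetric_Lax_Milgram[OF bounded_bilinear_re_ip re_ip_commute, of 1 "\<lambda>x. re_part (\<phi> x)"]
      bounded_linear_compose[OF bounded_linear_re_part bl]
    by (auto simp: re_ip_self)
  have "\<phi> x = ip x v" for x
  proof -
    define d where "d = \<phi> x - ip x v"
    have "re_part (\<phi> (scl (conj d) x)) = re_part (ip (scl (conj d) x) v)"
      by (metis v re_ip_commute)
    then have "re_part (conj d * d) = 0"
      by (simp add: d_def hom ip_scale_left right_diff_distrib re_part_simps)
    then show ?thesis by (simp add: re_part_conj_mult d_def)
  qed
  then show ?thesis using that by blast
qed

lemma positive_bounded_below:
  assumes S: "bounded_operator scl scl S" "positive_operator ip S"
    and below: "\<And>h. norm h \<le> K * norm (S h)"
  shows "invertible_operator scl S" and "(norm h)\<^sup>2 \<le> K * re_part (ip (S h) h)"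
proof -
  have bl: "bounded_linear S" and hom: "\<And>c x. S (scl c x) = scl c (S x)"
    using S by (auto simp: bounded_operator_def)
  note lin = linear_add[OF bounded_linear.linear[OF bl]] linear_diff[OF bounded_linear.linear[OF bl]]
    linear_scale[OF bounded_linear.linear[OF bl]]
  define s where "s = (\<lambda>x y. re_part (ip (S x) y))"
  have selfadj: "ip (S x) y = ip x (S y)" and pos: "0 \<le> s x x" for x y
    using S by (auto simp: positive_operator_def s_def)
  have bb: "bounded_bilinear s"
    unfolding s_def by (rule bounded_bilinear.comp1[OF bounded_bilinear_re_ip bl])
  have sym: "s x y = s y x" for x y
    unfolding s_def by (metis selfadj re_ip_commute)
  have bil: "bilinear s"
    by (auto simp: bilinear_def s_def lin ip_add_left ip_add_right ip_scaleR_left ip_scaleR_right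
      re_part_simps re_part_of_real_mult intro!: linearI)
  note CS = semidefinite_Cauchy_Schwarz[OF bil sym pos]
  obtain b where b: "\<And>x. norm (S x) \<le> norm x * b" "b > 0"
    using bounded_linear.pos_bounded[OF bl] by auto
  \<comment> \<open>Cauchy-Schwarz for \<open>s\<close> at the pair \<open>x\<close>,
    \<open>S x\<close> bounds the fourth power of \<open>norm (S x)\<close> by
    \<open>s x x * s (S x) (S x)\<close>; the second factor is at most b times the square of
    \<open>norm (S x)\<close>.\<close>
  have Sb: "(norm (S x))\<^sup>2 \<le> b * s x x" for x
  proof (cases "S x = 0")
    case False
    have "s (S x) (S x) \<le> norm (S (S x)) * norm (S x)"
      unfolding s_def by (rule re_ip_le)
    also have "\<dots> \<le> (norm (S x) * b) * norm (S x)"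
      by (intro mult_right_mono b) simp
    finally have "s x x * s (S x) (S x) \<le> s x x * (b * (norm (S x))\<^sup>2)"
      using pos[of x] by (intro mult_left_mono) (auto simp: power2_eq_square mult_ac)
    moreover have "((norm (S x))\<^sup>2)\<^sup>2 \<le> s x x * s (S x) (S x)"
      using CS[of x "S x"] by (simp add: s_def re_ip_self)
    ultimately have "(norm (S x))\<^sup>2 * (norm (S x))\<^sup>2 \<le> (b * s x x) * (norm (S x))\<^sup>2"
      by (simp add: power2_eq_square mult_ac)
    then show ?thesis using False by (subst (asm) mult_le_cancel_right_pos) simp_all
  qed (use pos b in simp)
  \<comment> \<open>Combining \<open>below\<close> with \<open>Sb\<close> gives coercivity with
    constant 1/(K^2 b). The added 1 keeps the denominator positive when K = 0, which the zero space
    permits.\<close>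
  define a where "a = inverse (K\<^sup>2 * b + 1)"
  have a: "0 < a" "K\<^sup>2 * b * a \<le> 1"
  proof -
    have "0 \<le> K\<^sup>2 * b" using b(2) by simp
    then show "0 < a" "K\<^sup>2 * b * a \<le> 1" by (auto simp: a_def field_simps)
  qed
  have coercive: "a * (norm x)\<^sup>2 \<le> s x x" for x
  proof -
    have "(norm x)\<^sup>2 \<le> (K * norm (S x))\<^sup>2" by (intro power_mono below) simp
    also have "\<dots> = K\<^sup>2 * (norm (S x))\<^sup>2" by (simp add: power_mult_distrib)
    also have "\<dots> \<le> K\<^sup>2 * (b * s x x)" by (intro mult_left_mono Sb) simp
    finally have "a * (norm x)\<^sup>2 \<le> a * (K\<^sup>2 * (b * s x x))" using a by simp
    also have "\<dots> = (K\<^sup>2 * b * a) * s x x" by simp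
    also have "\<dots> \<le> s x x" using mult_right_mono[OF a(2) pos[of x]] by simp
    finally show ?thesis .
  qed
  have "\<exists>x. S x = w" for w
  proof -
    \<comment> \<open>The weak form of S x = w; testing it with S x - w yields the equation
      itself.\<close>
    obtain x where x: "\<And>y. s x y = re_part (ip w y)"
      using symmetric_Lax_Milgram[OF bb sym a(1) coercive
          bounded_bilinear.bounded_linear_right[OF bounded_bilinear_re_ip]] by blast
    have "re_part (ip (S x - w) (S x - w)) = 0"
      using x[of "S x - w"] by (simp add: s_def ip_diff_left re_part_simps)
    then show ?thesis by (simp add: re_ip_self) blast
  qed
  then have surj: "surj S" by (metis surjI)
  have inj: "inj S"
  proof (rule injI)
    fix x y assume "S x = S y"
    then show "x = y" using below[of "x - y"] by (simp add: lin)
  qed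
  have S_inv: "S (inv S x) = x" for x by (simp add: surj surj_f_inv_f)
  have inv_S: "inv S (S x) = x" for x by (simp add: inj)
  have inv_le: "norm (inv S x) \<le> K * norm x" for x
    using below[of "inv S x"] by (simp add: S_inv)
  have "bounded_linear (inv S)"
  proof (rule bounded_linear_intro[of _ K])
    show "inv S (x + y) = inv S x + inv S y" for x y by (metis S_inv inv_S lin(1))
    show "inv S (r *\<^sub>R x) = r *\<^sub>R inv S x" for r x by (metis S_inv inv_S lin(3))
    show "norm (inv S x) \<le> norm x * K" for x using inv_le[of x] by (simp add: mult.commute)
  qed
  moreover have "inv S (scl c x) = scl c (inv S x)" for c x by (metis S_inv inv_S hom)
  ultimately show "invertible_operator scl S"
    using S inj surj by (auto simp: invertible_operator_def bounded_operator_def bij_def)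
  show "(norm h)\<^sup>2 \<le> K * re_part (ip (S h) h)"
  proof (cases "h = 0")
    case True
    then show ?thesis using linear_0[OF bounded_linear.linear[OF bl]] re_ip_self[of 0] by simp
  next
    case False
    \<comment> \<open>With \<open>inv S h\<close> as partner the mixed term of Cauchy-Schwarz is
      exactly the squared norm of \<open>h\<close>, and \<open>K\<close> enters only to the first
      power. This is why the constant is better than \<open>a\<close>.\<close>
    have "s h (inv S h) = (norm h)\<^sup>2"
      using sym[of h "inv S h"] by (simp add: s_def S_inv re_ip_self)
    then have "((norm h)\<^sup>2)\<^sup>2 \<le> s h h * s (inv S h) (inv S h)"
      using CS[of h "inv S h"] by simp
    also have "\<dots> \<le> s h h * (K * (norm h)\<^sup>2)"
    proof (intro mult_left_mono pos)
      have "s (inv S h) (inv S h) \<le> norm h * norm (inv S h)"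
        using re_ip_le[of h "inv S h"] by (simp add: s_def S_inv)
      also have "\<dots> \<le> norm h * (K * norm h)" by (intro mult_left_mono inv_le) simp
      finally show "s (inv S h) (inv S h) \<le> K * (norm h)\<^sup>2"
        by (simp add: power2_eq_square mult_ac)
    qed
    finally have "(norm h)\<^sup>2 * (norm h)\<^sup>2 \<le> (K * s h h) * (norm h)\<^sup>2"
      by (simp add: power2_eq_square mult_ac)
    then show ?thesis using False by (subst (asm) mult_le_cancel_right_pos) (simp_all add: s_def)
  qed
qed

section \<open>Weak integrals and adjoints\<close>

lemma has_weak_integral_unique:
  "has_weak_integral ip M F v \<Longrightarrow> has_weak_integral ip M F w \<Longrightarrow> v = w"
  by (rule eq_if_ip_eq) (simp add: has_weak_integral_def)

lemma weak_integral_eqI: "has_weak_integral ip M F v \<Longrightarrow> weak_integral ip M F = v"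
  unfolding weak_integral_def by (blast intro: has_weak_integral_unique)

lemma has_weak_integral_weak_integral:
  "weakly_integrable ip M F \<Longrightarrow> has_weak_integral ip M F (weak_integral ip M F)"
  by (metis weakly_integrable_def weak_integral_eqI)

lemma has_weak_integral_add:
  "has_weak_integral ip M F v \<Longrightarrow> has_weak_integral ip M G w \<Longrightarrow>
    has_weak_integral ip M (\<lambda>\<alpha>. F \<alpha> + G \<alpha>) (v + w)"
  by (simp add: has_weak_integral_def ip_add_left)

lemma has_weak_integral_diff:
  "has_weak_integral ip M F v \<Longrightarrow> has_weak_integral ip M G w \<Longrightarrow>
    has_weak_integral ip M (\<lambda>\<alpha>. F \<alpha> - G \<alpha>) (v - w)"
  by (simp add: has_weak_integral_def ip_diff_left)

lemma has_weak_integral_scale: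
  "has_weak_integral ip M F v \<Longrightarrow> has_weak_integral ip M (\<lambda>\<alpha>. scl c (F \<alpha>)) (scl c v)"
  by (simp add: has_weak_integral_def ip_scale_left)

text \<open>Identities between operators of a family are available on \<open>space M\<close> only,
  not on the whole index type.\<close>

lemma has_weak_integral_cong:
  assumes "\<And>\<alpha>. \<alpha> \<in> space M \<Longrightarrow> F \<alpha> = G \<alpha>"
  shows "has_weak_integral ip M F v \<longleftrightarrow> has_weak_integral ip M G v"
proof -
  have "integrable M (\<lambda>\<alpha>. ip (F \<alpha>) g) = integrable M (\<lambda>\<alpha>. ip (G \<alpha>) g)"
    and "(LINT \<alpha>|M. ip (F \<alpha>) g) = (LINT \<alpha>|M. ip (G \<alpha>) g)" for g
    using assms
    by (intro Bochner_Integration.integrable_cong Bochner_Integration.integral_cong; simp)+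
  then show ?thesis by (simp add: has_weak_integral_def)
qed

end

text \<open>Riesz representation of x |-> <T x, y> for each y produces a candidate, and
  nondegeneracy of \<open>ip\<close> makes it the only one, so the description in
  \<open>adjoint_op\<close> denotes it. The second equation is the conjugate of the first.\<close>

lemma adjoint_op:
  fixes scl :: "'k::real_or_complex \<Rightarrow> 'h::banach \<Rightarrow> 'h" and scl' :: "'k \<Rightarrow> 'g::banach \<Rightarrow> 'g"
  assumes "hilbert_space_over scl ip" "hilbert_space_over scl' ip'" "bounded_operator scl scl' T"
  shows "ip' (T x) y = ip x (adjoint_op ip ip' T y)" and "ip' y (T x) = ip (adjoint_op ip ip' T y) x"
proof -
  interpret H: hilbert_space_over scl ip by fact
  interpret G: hilbert_space_over scl' ip' by fact
  have T: "bounded_linear T" "\<And>c x. T (scl c x) = scl' c (T x)"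
    using assms(3) by (auto simp: bounded_operator_def)
  have "\<exists>v. \<forall>x. ip' (T x) y = ip x v" for y
    using H.Riesz_representation[OF bounded_linear_compose[OF G.bounded_linear_ip_left T(1)], of y]
    by (metis T(2) G.ip_scale_left)
  then obtain T' where T': "\<And>x y. ip' (T x) y = ip x (T' y)" by metis
  have "T'' = T'" if "\<forall>x y. ip' (T x) y = ip x (T'' y)" for T''
  proof
    fix y show "T'' y = T' y"
      by (rule H.eq_if_ip_eq) (metis that T' H.ip_conj)
  qed
  then have "adjoint_op ip ip' T = T'"
    unfolding adjoint_op_def using T' by (intro the_equality) auto
  with T' show *: "ip' (T x) y = ip x (adjoint_op ip ip' T y)" for x y by simp
  show "ip' y (T x) = ip (adjoint_op ip ip' T y) x"
    by (metis * H.ip_conj G.ip_conj)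
qed

section \<open>Integrability over semifinite measures\<close>

text \<open>Otherwise the supremum of the finite measures of subsets of \<open>E\<close> is attained at some
  \<open>U\<close>, and \<open>E - U\<close> contains a set of finite positive measure.\<close>

lemma semi_finite_measure_large_subset:
  assumes sf: "semi_finite_measure M" and E: "E \<in> sets M" "emeasure M E = \<infinity>" and c: "c < \<infinity>"
  obtains F where "F \<in> sets M" "F \<subseteq> E" "c < emeasure M F" "emeasure M F < \<infinity>"
proof (rule ccontr)
  note large = that
  assume no: "\<not> thesis"
  define Q where "Q = {F \<in> sets M. F \<subseteq> E \<and> emeasure M F < \<infinity>}"
  have le: "emeasure M F \<le> c" if "F \<in> Q" for F
    using no large[of F] that by (auto simp: Q_def not_less[symmetric])
  have "Q \<noteq> {}" by (auto simp: Q_def)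
  from ennreal_SUP_countable_SUP[OF this, of "emeasure M"]
  obtain m :: "nat \<Rightarrow> ennreal"
    where m: "range m \<subseteq> emeasure M ` Q" "(SUP F\<in>Q. emeasure M F) = (SUP n. m n)"
    by auto
  then have "\<forall>n. \<exists>F\<in>Q. m n = emeasure M F" by auto
  then obtain G where G: "\<And>n::nat. G n \<in> Q" "\<And>n. m n = emeasure M (G n)" by metis
  \<comment> \<open>Finite unions make the maximising sequence increasing without leaving
    \<open>Q\<close>. Continuity from below then keeps the measure of the limit \<open>U\<close>
    below \<open>c\<close>, hence finite.\<close>
  define H where "H n = (\<Union>i\<le>n. G i)" for n
  have H: "H n \<in> Q" for n
  proof (induction n)
    case (Suc n)
    then have "emeasure M (H n \<union> G (Suc n)) \<le> emeasure M (H n) + emeasure M (G (Suc n))"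
      using G(1)[of "Suc n"] by (intro emeasure_subadditive) (auto simp: Q_def)
    also have "emeasure M (H n) + emeasure M (G (Suc n)) < \<infinity>" using Suc G(1)[of "Suc n"] by (auto simp: Q_def)
    finally have "emeasure M (H n \<union> G (Suc n)) < \<infinity>" .
    moreover have "H (Suc n) = H n \<union> G (Suc n)" by (auto simp: H_def atMost_Suc)
    ultimately show ?case using Suc G(1)[of "Suc n"] by (auto simp: Q_def)
  qed (use G in \<open>simp add: H_def\<close>)
  define U where "U = (\<Union>n. H n)"
  have "(SUP n. emeasure M (H n)) = emeasure M U"
    unfolding U_def
    using H by (intro SUP_emeasure_incseq) (auto simp: Q_def H_def incseq_def intro: order_trans)
  then have "emeasure M U \<le> c" using H le by (metis SUP_least)
  then have UQ: "U \<in> Q" using H c by (auto simp: Q_def U_def)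
  have "m n \<le> emeasure M U" for n
    unfolding G(2) using UQ by (intro emeasure_mono) (auto simp: H_def U_def Q_def)
  then have max: "emeasure M F \<le> emeasure M U" if "F \<in> Q" for F
    using m(2) that by (metis SUP_least SUP_upper order_trans)
  have U: "U \<in> sets M" "U \<subseteq> E" "emeasure M U < \<infinity>" using UQ by (auto simp: Q_def)
  have "emeasure M (E - U) = \<infinity> - emeasure M U"
    using U E by (simp add: emeasure_Diff)
  then have "emeasure M (E - U) = \<infinity>"
    using U(3) by (simp add: ennreal_top_minus)
  moreover have "E - U \<in> sets M" using E UQ by (auto simp: Q_def)
  ultimately obtain F where F: "F \<in> sets M" "F \<subseteq> E - U" "0 < emeasure M F" "emeasure M F < \<infinity>"
    using sf unfolding semi_finite_measure_def by blast
  have eq: "emeasure M (U \<union> F) = emeasure M U + emeasure M F"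
    using F UQ by (subst plus_emeasure) (auto simp: Q_def)
  then have "U \<union> F \<in> Q" using F UQ by (auto simp: Q_def)
  then have "emeasure M U + emeasure M F \<le> emeasure M U + 0"
    using max[of "U \<union> F"] eq by simp
  then have "emeasure M F = 0"
    using UQ F(3) by (subst (asm) ennreal_add_left_cancel_le) (auto simp: Q_def)
  with F show False by simp
qed

text \<open>The bound \<open>le\<close> is demanded only where a cut-off function is sure to be
  square integrable. The level sets \<open>E n\<close> exhaust the points with p > 0; once they have
  finite measure, monotone convergence carries the bound to the whole space.\<close>

lemma semi_finite_measure_integrable:
  fixes p :: "'a \<Rightarrow> real"
  assumes sf: "semi_finite_measure M" and p[measurable]: "p \<in> borel_measurable M"
    and nonneg: "\<And>x. 0 \<le> p x" and C: "0 \<le> C"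
    and le: "\<And>E. E \<in> sets M \<Longrightarrow> emeasure M E < \<infinity> \<Longrightarrow> bdd_above (p ` E) \<Longrightarrow>
      (\<integral>\<^sup>+x\<in>E. p x \<partial>M) \<le> ennreal C"
  shows "integrable M p" and "(LINT x|M. p x) \<le> C"
proof -
  define E where "E n = {x \<in> space M. 1 / real (Suc n) \<le> p x \<and> p x \<le> real (Suc n)}" for n
  have E[measurable]: "E n \<in> sets M" for n unfolding E_def by measurable
  have fin: "emeasure M (E n) < \<infinity>" for n
  proof (rule ccontr)
    assume "\<not> ?thesis"
    then have "emeasure M (E n) = \<infinity>" by (simp add: less_top[symmetric])
    \<comment> \<open>On \<open>E n\<close> the function is at least 1/(n+1), so a subset of finite
      measure above C (n+1) would have integral above \<open>C\<close>.\<close>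
    from semi_finite_measure_large_subset[OF sf E this, of "ennreal (C * real (Suc n))"]
    obtain F where F: "F \<in> sets M" "F \<subseteq> E n" "ennreal (C * real (Suc n)) < emeasure M F"
      "emeasure M F < \<infinity>" by auto
    have "ennreal (1 / real (Suc n)) * emeasure M F = (\<integral>\<^sup>+x. ennreal (1 / real (Suc n)) * indicator F x \<partial>M)"
      using F by (simp add: nn_integral_cmult_indicator)
    also have "\<dots> \<le> (\<integral>\<^sup>+x\<in>F. p x \<partial>M)"
      using F by (intro nn_integral_mono) (auto simp: indicator_def E_def intro!: ennreal_leI)
    also have "\<dots> \<le> ennreal C"
      using F by (intro le bdd_aboveI2[of _ _ "real (Suc n)"]) (auto simp: E_def)
    finally have "ennreal (real (Suc n)) * (ennreal (1 / real (Suc n)) * emeasure M F)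
        \<le> ennreal (real (Suc n)) * ennreal C"
      by (rule mult_left_mono) simp
    moreover have "ennreal (real (Suc n)) * ennreal (1 / real (Suc n)) = 1"
      by (subst ennreal_mult[symmetric]) auto
    ultimately have "emeasure M F \<le> ennreal (real (Suc n)) * ennreal C"
      by (simp only: mult.assoc[symmetric] mult_1_left)
    also have "\<dots> = ennreal (C * real (Suc n))"
      using C by (subst ennreal_mult[symmetric]) (auto simp only: mult.commute of_nat_0_le_iff)
    finally have "emeasure M F \<le> ennreal (C * real (Suc n))" .
    with F show False by simp
  qed
  define q where "q n x = ennreal (p x) * indicator (E n) x" for n x
  have [measurable]: "q n \<in> borel_measurable M" for n unfolding q_def by measurable
  have inc: "E n \<subseteq> E k" if "n \<le> k" for n k
  proof -
    have "1 / real (Suc k) \<le> 1 / real (Suc n)" using that by (intro divide_left_mono) auto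
    then show ?thesis using that by (auto simp: E_def)
  qed
  have "incseq q"
    using inc by (auto simp: incseq_def le_fun_def q_def indicator_def)
  then have "(\<integral>\<^sup>+x. (SUP n. q n x) \<partial>M) = (SUP n. integral\<^sup>N M (q n))"
    by (intro nn_integral_monotone_convergence_SUP) auto
  also have "\<dots> \<le> ennreal C"
  proof (rule SUP_least)
    show "integral\<^sup>N M (q n) \<le> ennreal C" for n
      unfolding q_def using fin by (intro le bdd_aboveI2[of _ _ "real (Suc n)"]) (auto simp: E_def)
  qed
  also have "(\<integral>\<^sup>+x. (SUP n. q n x) \<partial>M) = (\<integral>\<^sup>+x. p x \<partial>M)"
  proof (rule nn_integral_cong)
    fix x assume x: "x \<in> space M"
    show "(SUP n. q n x) = ennreal (p x)"
    proof (rule antisym)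
      show "(SUP n. q n x) \<le> ennreal (p x)"
        by (rule SUP_least) (auto simp: q_def indicator_def)
      show "ennreal (p x) \<le> (SUP n. q n x)"
      proof (cases "p x = 0")
        case False
        then have pos: "p x > 0" using nonneg[of x] by simp
        obtain n where n: "max (p x) (1 / p x) \<le> real n" using real_arch_simple by blast
        then have "p x \<le> real (Suc n)" "1 / p x \<le> real (Suc n)" by auto
        then have "x \<in> E n" using pos x by (auto simp: E_def field_simps)
        then have "ennreal (p x) = q n x" by (simp add: q_def)
        then show ?thesis by (metis SUP_upper UNIV_I)
      qed simp
    qed
  qed
  finally have nn: "(\<integral>\<^sup>+x. p x \<partial>M) \<le> ennreal C" .
  show int: "integrable M p"
    using nn nonneg by (intro integrableI_nonneg) (auto simp: le_less_trans)
  show "(LINT x|M. p x) \<le> C"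
    using nn nn_integral_eq_integral[OF int] nonneg C by simp
qed

section \<open>Square integrable functions and operators into them\<close>

lemma L2_norm_power2: "(L2_norm M f)\<^sup>2 = (LINT \<alpha>|M. (norm (f \<alpha>))\<^sup>2)"
  by (simp add: L2_norm_def)

lemma L2_norm_nonneg [simp]: "0 \<le> L2_norm M f"
  by (simp add: L2_norm_def)

lemma L2_norm_measurable: "f \<in> L2 M \<Longrightarrow> (\<lambda>\<alpha>. norm (f \<alpha>)) \<in> borel_measurable M"
  unfolding L2_def strongly_measurable_def by auto

lemma L2_Cauchy_Schwarz:
  assumes f: "f \<in> L2 M" and g: "g \<in> L2 M"
  shows "integrable M (\<lambda>\<alpha>. norm (f \<alpha>) * norm (g \<alpha>))"
    and "(LINT \<alpha>|M. norm (f \<alpha>) * norm (g \<alpha>)) \<le> L2_norm M f * L2_norm M g"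
proof -
  note [measurable] = L2_norm_measurable[OF f] L2_norm_measurable[OF g]
  have fi: "integrable M (\<lambda>\<alpha>. (norm (f \<alpha>))\<^sup>2)" and gi: "integrable M (\<lambda>\<alpha>. (norm (g \<alpha>))\<^sup>2)"
    using f g by (auto simp: L2_def)
  show int: "integrable M (\<lambda>\<alpha>. norm (f \<alpha>) * norm (g \<alpha>))"
  proof (rule Bochner_Integration.integrable_bound[OF Bochner_Integration.integrable_add[OF fi gi]])
    have "x * y \<le> x\<^sup>2 + y\<^sup>2" if "0 \<le> x" "0 \<le> y" for x y :: real
      using sum_squares_bound[of x y] mult_nonneg_nonneg[OF that] by linarith
    then show "AE \<alpha> in M. norm (norm (f \<alpha>) * norm (g \<alpha>)) \<le> norm ((norm (f \<alpha>))\<^sup>2 + (norm (g \<alpha>))\<^sup>2)"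
      by (intro AE_I2) simp
  qed measurable
  let ?I = "LINT \<alpha>|M. norm (f \<alpha>) * norm (g \<alpha>)"
  have "(ennreal ?I)\<^sup>2 = (\<integral>\<^sup>+\<alpha>. ennreal (norm (f \<alpha>)) * ennreal (norm (g \<alpha>)) \<partial>M)\<^sup>2"
    using nn_integral_eq_integral[OF int] by (simp add: ennreal_mult)
  also have "\<dots> \<le> (\<integral>\<^sup>+\<alpha>. (ennreal (norm (f \<alpha>)))\<^sup>2 \<partial>M) * (\<integral>\<^sup>+\<alpha>. (ennreal (norm (g \<alpha>)))\<^sup>2 \<partial>M)"
    by (rule Cauchy_Schwarz_nn_integral) measurable
  also have "\<dots> = ennreal ((L2_norm M f)\<^sup>2) * ennreal ((L2_norm M g)\<^sup>2)"
    using nn_integral_eq_integral[OF fi] nn_integral_eq_integral[OF gi]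
    by (simp add: L2_norm_power2 ennreal_power)
  also have "\<dots> = ennreal ((L2_norm M f * L2_norm M g)\<^sup>2)"
    by (simp add: ennreal_mult power_mult_distrib)
  finally have "?I\<^sup>2 \<le> (L2_norm M f * L2_norm M g)\<^sup>2"
    by (simp add: ennreal_power)
  then show "?I \<le> L2_norm M f * L2_norm M g"
    by (rule power2_le_imp_le) simp
qed

text \<open>The hypothesis makes the supremum a genuine one. At h = 0 the quotient is 0 by the
  convention for division by zero, which gives nonnegativity and explains \<open>max 0 C\<close>: in
  the zero space \<open>C\<close> may be negative.\<close>

lemma onorm_L2:
  assumes "\<And>h. L2_norm M (T h) \<le> C * norm h"
  shows "L2_norm M (T h) \<le> onorm_L2 M T * norm h" and "0 \<le> onorm_L2 M T"
proof -
  have bdd: "bdd_above (range (\<lambda>h. L2_norm M (T h) / norm h))"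
  proof (rule bdd_aboveI2)
    show "L2_norm M (T h) / norm h \<le> max 0 C" for h
    proof (cases "h = 0")
      case False
      have "C * norm h \<le> max 0 C * norm h" by (intro mult_right_mono) auto
      then have "L2_norm M (T h) \<le> max 0 C * norm h" using assms[of h] by linarith
      then show ?thesis using False by (simp add: divide_le_eq)
    qed simp
  qed
  have up: "L2_norm M (T h) / norm h \<le> onorm_L2 M T" for h
    unfolding onorm_L2_def by (rule cSUP_upper[OF _ bdd]) simp
  show "0 \<le> onorm_L2 M T" using up[of 0] by simp
  show "L2_norm M (T h) \<le> onorm_L2 M T * norm h"
    using up[of h] assms[of h] by (cases "h = 0") (auto simp: divide_le_eq)
qed

text \<open>Zero is adjoined to the countable set because the cut-off function takes this value
  outside \<open>E\<close>.\<close>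

lemma strongly_measurable_restrict:
  assumes f: "strongly_measurable M f" and E: "E \<in> sets M"
  shows "strongly_measurable M (\<lambda>\<alpha>. if \<alpha> \<in> E then f \<alpha> else 0)"
proof -
  obtain D where D: "countable D" "f ` space M \<subseteq> closure D"
    using f by (auto simp: strongly_measurable_def)
  have [measurable]: "f \<in> borel_measurable M" "E \<in> sets M"
    using f E by (auto simp: strongly_measurable_def)
  have "(\<lambda>\<alpha>. if \<alpha> \<in> E then f \<alpha> else 0) \<in> borel_measurable M" by measurable
  moreover have "(\<lambda>\<alpha>. if \<alpha> \<in> E then f \<alpha> else 0) ` space M \<subseteq> closure (insert 0 D)"
  proof -
    have "closure D \<subseteq> closure (insert 0 D)" by (intro closure_mono) auto
    moreover have "0 \<in> closure (insert 0 D)" using closure_subset by blast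
    ultimately show ?thesis using D(2) sets.sets_into_space[OF E] by (auto simp: image_subset_iff)
  qed
  ultimately show ?thesis
    unfolding strongly_measurable_def using D(1) by blast
qed

section \<open>Duality between analysis and synthesis operators\<close>

text \<open>The test functions are \<open>B h\<close> cut off to sets of finite measure on which it is bounded.\<close>

lemma analysis_op_bounded_dual:
  fixes scl :: "'k::real_or_complex \<Rightarrow> 'h::banach \<Rightarrow> 'h" and scl' :: "'k \<Rightarrow> 'g::banach \<Rightarrow> 'g"
  assumes H: "hilbert_space_over scl ip" and G: "hilbert_space_over scl' ip'"
    and sf: "semi_finite_measure M"
    and B: "\<And>\<alpha>. \<alpha> \<in> space M \<Longrightarrow> bounded_operator scl scl' (B \<alpha>)"
    and meas: "\<And>h. strongly_measurable M (\<lambda>\<alpha>. B \<alpha> h)"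
    and W: "\<And>f. f \<in> L2 M \<Longrightarrow> has_weak_integral ip M (\<lambda>\<alpha>. adjoint_op ip ip' (B \<alpha>) (f \<alpha>)) (W f)"
    and C: "0 \<le> C" "\<And>f. f \<in> L2 M \<Longrightarrow> norm (W f) \<le> C * L2_norm M f"
  shows "analysis_op_bounded M B"
proof -
  interpret H: hilbert_space_over scl ip by fact
  interpret G: hilbert_space_over scl' ip' by fact
  have *: "integrable M (\<lambda>\<alpha>. (norm (B \<alpha> h))\<^sup>2) \<and> (LINT \<alpha>|M. (norm (B \<alpha> h))\<^sup>2) \<le> (C * norm h)\<^sup>2" for h
  proof -
    have Bm[measurable]: "(\<lambda>\<alpha>. norm (B \<alpha> h)) \<in> borel_measurable M"
      using meas[of h] unfolding strongly_measurable_def by auto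
    have key: "(\<integral>\<^sup>+\<alpha>\<in>E. (norm (B \<alpha> h))\<^sup>2 \<partial>M) \<le> ennreal ((C * norm h)\<^sup>2)"
      if E[measurable]: "E \<in> sets M" and fin: "emeasure M E < \<infinity>"
        and bdd: "bdd_above ((\<lambda>\<alpha>. (norm (B \<alpha> h))\<^sup>2) ` E)" for E
    proof -
      obtain n where n: "\<And>\<alpha>. \<alpha> \<in> E \<Longrightarrow> (norm (B \<alpha> h))\<^sup>2 \<le> n"
        using bdd by (auto simp: bdd_above_def)
      define f where "f = (\<lambda>\<alpha>. if \<alpha> \<in> E then B \<alpha> h else 0)"
      have f_norm: "(norm (f \<alpha>))\<^sup>2 = indicator E \<alpha> *\<^sub>R (norm (B \<alpha> h))\<^sup>2" for \<alpha>
        by (auto simp: f_def indicator_def)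
      have int: "integrable M (\<lambda>\<alpha>. (norm (f \<alpha>))\<^sup>2)"
        unfolding f_norm using n fin
        by (intro integrableI_bounded_set_indicator[where B = n] AE_I2) auto
      then have f: "f \<in> L2 M"
        using strongly_measurable_restrict[OF meas[of h] E] by (auto simp: L2_def f_def)
      have w: "integrable M (\<lambda>\<alpha>. ip (adjoint_op ip ip' (B \<alpha>) (f \<alpha>)) h)"
        "ip (W f) h = (LINT \<alpha>|M. ip (adjoint_op ip ip' (B \<alpha>) (f \<alpha>)) h)"
        using W[OF f] by (auto simp: has_weak_integral_def)
      \<comment> \<open>Since f agrees with B h on \<open>E\<close> and vanishes elsewhere, pairing
        \<open>W f\<close> with \<open>h\<close> gives the squared norm of f. The bound on
        \<open>W\<close> then allows one factor \<open>L2_norm M f\<close> to be cancelled.\<close>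
      have "re_part (ip (W f) h) = (LINT \<alpha>|M. re_part (ip (adjoint_op ip ip' (B \<alpha>) (f \<alpha>)) h))"
        unfolding w(2) by (rule integral_bounded_linear[OF bounded_linear_re_part w(1), symmetric])
      also have "\<dots> = (LINT \<alpha>|M. (norm (f \<alpha>))\<^sup>2)"
      proof (rule Bochner_Integration.integral_cong[OF refl])
        fix \<alpha> assume "\<alpha> \<in> space M"
        then have "ip (adjoint_op ip ip' (B \<alpha>) (f \<alpha>)) h = ip' (f \<alpha>) (B \<alpha> h)"
          using adjoint_op(2)[OF H G B] by simp
        also have "re_part \<dots> = (norm (f \<alpha>))\<^sup>2"
          using G.re_ip_self bilinear_lzero[OF G.bilinear_re_ip] by (auto simp: f_def)
        finally show "re_part (ip (adjoint_op ip ip' (B \<alpha>) (f \<alpha>)) h) = (norm (f \<alpha>))\<^sup>2" .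
      qed
      also have "\<dots> = (L2_norm M f)\<^sup>2" by (simp add: L2_norm_power2)
      finally have "(L2_norm M f)\<^sup>2 \<le> norm (W f) * norm h"
        using H.re_ip_le[of "W f" h] by simp
      also have "\<dots> \<le> (C * L2_norm M f) * norm h"
        by (intro mult_right_mono C f) simp
      finally have "L2_norm M f * L2_norm M f \<le> L2_norm M f * (C * norm h)"
        by (simp add: power2_eq_square mult_ac)
      then have "L2_norm M f \<le> C * norm h"
        using C(1) by (cases "L2_norm M f = 0") (auto simp: mult_le_cancel_left less_le)
      then have "(LINT \<alpha>|M. (norm (f \<alpha>))\<^sup>2) \<le> (C * norm h)\<^sup>2"
        by (subst L2_norm_power2[symmetric]) (intro power_mono, auto)
      moreover have "(\<integral>\<^sup>+\<alpha>\<in>E. (norm (B \<alpha> h))\<^sup>2 \<partial>M) = (\<integral>\<^sup>+\<alpha>. (norm (f \<alpha>))\<^sup>2 \<partial>M)"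
        by (intro nn_integral_cong) (auto simp: f_def indicator_def)
      ultimately show ?thesis
        using nn_integral_eq_integral[OF int] by (simp add: ennreal_leI)
    qed
    have "(\<lambda>\<alpha>. (norm (B \<alpha> h))\<^sup>2) \<in> borel_measurable M" by measurable
    note semi_finite_measure_integrable[OF sf this zero_le_power2 zero_le_power2 key]
    then show ?thesis by blast
  qed
  have "analysis_op B h \<in> L2 M" for h
    using * meas by (simp add: L2_def analysis_op_def)
  moreover have "L2_norm M (analysis_op B h) \<le> C * norm h" for h
    using * C(1) unfolding L2_norm_def analysis_op_def by (intro real_le_lsqrt) auto
  ultimately show ?thesis by (auto simp: analysis_op_bounded_def)
qed

text \<open>A positive frame operator is its own adjoint, whence \<open>S = \<theta>\<^sub>A\<^sup>* \<theta>\<^sub>\<Psi>\<close> besides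
  \<open>S = \<theta>\<^sub>\<Psi>\<^sup>* \<theta>\<^sub>A\<close>.\<close>

lemma has_weak_integral_frame_op_swap:
  fixes scl :: "'k::real_or_complex \<Rightarrow> 'h::banach \<Rightarrow> 'h" and scl' :: "'k \<Rightarrow> 'g::banach \<Rightarrow> 'g"
  assumes H: "hilbert_space_over scl ip" and G: "hilbert_space_over scl' ip'"
    and F: "continuous_ovf scl ip scl' ip' M A \<Psi>"
  shows "has_weak_integral ip M (\<lambda>\<alpha>. adjoint_op ip ip' (A \<alpha>) (\<Psi> \<alpha> h)) (frame_op ip ip' M A \<Psi> h)"
proof -
  interpret H: hilbert_space_over scl ip by fact
  interpret G: hilbert_space_over scl' ip' by fact
  have A: "bounded_operator scl scl' (A \<alpha>)" and Psi: "bounded_operator scl scl' (\<Psi> \<alpha>)"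
    if "\<alpha> \<in> space M" for \<alpha>
    using F that by (auto simp: continuous_ovf_def)
  let ?S = "frame_op ip ip' M A \<Psi>"
  have sa: "ip (?S x) y = ip x (?S y)" for x y
    using F by (auto simp: continuous_ovf_def positive_operator_def)
  have w: "has_weak_integral ip M (\<lambda>\<alpha>. adjoint_op ip ip' (\<Psi> \<alpha>) (A \<alpha> g)) (?S g)" for g
    unfolding frame_op_def using F
    by (intro H.has_weak_integral_weak_integral) (auto simp: continuous_ovf_def)
  show ?thesis
    unfolding has_weak_integral_def
  proof
    fix g
    let ?u = "\<lambda>\<alpha>. ip (adjoint_op ip ip' (\<Psi> \<alpha>) (A \<alpha> g)) h"
    let ?v = "\<lambda>\<alpha>. ip (adjoint_op ip ip' (A \<alpha>) (\<Psi> \<alpha> h)) g"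
    have u: "integrable M ?u" "ip (?S g) h = (LINT \<alpha>|M. ?u \<alpha>)"
      using w[of g] by (auto simp: has_weak_integral_def)
    \<comment> \<open>One side pairs \<Psi> h with A g, the other A g with \<Psi> h. The conjugation
      left after integrating is undone by the self-adjointness of \<open>?S\<close>.\<close>
    have eq: "?v \<alpha> = conj (?u \<alpha>)" if "\<alpha> \<in> space M" for \<alpha>
      using adjoint_op(2)[OF H G A[OF that]] adjoint_op(2)[OF H G Psi[OF that]] G.ip_conj by metis
    have "integrable M ?v = integrable M (\<lambda>\<alpha>. conj (?u \<alpha>))"
      using eq by (intro Bochner_Integration.integrable_cong) auto
    moreover have "(LINT \<alpha>|M. ?v \<alpha>) = (LINT \<alpha>|M. conj (?u \<alpha>))"
      using eq by (intro Bochner_Integration.integral_cong) auto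
    moreover have "ip (?S h) g = conj (ip (?S g) h)" by (metis sa H.ip_conj)
    ultimately show "integrable M ?v \<and> ip (?S h) g = (LINT \<alpha>|M. ?v \<alpha>)"
      using u integrable_bounded_linear[OF bounded_linear_conj u(1)]
        integral_bounded_linear[OF bounded_linear_conj u(1)] by simp
  qed
qed

text \<open>Testing v against itself gives the integral of <f, A v>, which Cauchy-Schwarz bounds by
  the norm of f times that of theta_A v; one factor \<open>norm v\<close> cancels.\<close>

lemma synthesis_op_bounded:
  fixes scl :: "'k::real_or_complex \<Rightarrow> 'h::banach \<Rightarrow> 'h" and scl' :: "'k \<Rightarrow> 'g::banach \<Rightarrow> 'g"
  assumes H: "hilbert_space_over scl ip" and G: "hilbert_space_over scl' ip'"
    and A: "\<And>\<alpha>. \<alpha> \<in> space M \<Longrightarrow> bounded_operator scl scl' (A \<alpha>)"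
    and bd: "analysis_op_bounded M A" and f: "f \<in> L2 M"
    and w: "has_weak_integral ip M (\<lambda>\<alpha>. adjoint_op ip ip' (A \<alpha>) (f \<alpha>)) v"
  shows "norm v \<le> onorm_L2 M (analysis_op A) * L2_norm M f"
proof -
  interpret H: hilbert_space_over scl ip by fact
  interpret G: hilbert_space_over scl' ip' by fact
  let ?N = "onorm_L2 M (analysis_op A)"
  have N: "L2_norm M (analysis_op A v) \<le> ?N * norm v" "0 \<le> ?N"
    using bd onorm_L2[of M "analysis_op A"] by (auto simp: analysis_op_bounded_def)
  have Av: "analysis_op A v \<in> L2 M" using bd by (simp add: analysis_op_bounded_def)
  have "(norm v)\<^sup>2 \<le> norm (ip v v)" using H.re_ip_self re_part_le_norm abs_ge_self order_trans by metis
  also have "\<dots> = norm (LINT \<alpha>|M. ip (adjoint_op ip ip' (A \<alpha>) (f \<alpha>)) v)"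
    using w by (simp add: has_weak_integral_def)
  also have "\<dots> \<le> (LINT \<alpha>|M. norm (ip (adjoint_op ip ip' (A \<alpha>) (f \<alpha>)) v))"
    by (rule integral_norm_bound)
  also have "\<dots> \<le> (LINT \<alpha>|M. norm (f \<alpha>) * norm (analysis_op A v \<alpha>))"
    using w adjoint_op(2)[OF H G A, symmetric] G.norm_ip_le
    by (intro Bochner_Integration.integral_mono L2_Cauchy_Schwarz f Av integrable_norm)
      (auto simp: has_weak_integral_def analysis_op_def)
  also have "\<dots> \<le> L2_norm M f * (?N * norm v)"
    by (rule order_trans[OF L2_Cauchy_Schwarz(2)[OF f Av]]) (intro mult_left_mono N, simp)
  finally have "norm v * norm v \<le> (?N * L2_norm M f) * norm v"
    by (simp add: power2_eq_square mult_ac)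
  then show ?thesis
    using N by (cases "v = 0") auto
qed

theorem theorem5p1:
  fixes scl :: "'k::real_or_complex \<Rightarrow> 'h::banach \<Rightarrow> 'h" and ip :: "'h \<Rightarrow> 'h \<Rightarrow> 'k"
    and scl0 :: "'k \<Rightarrow> 'g::banach \<Rightarrow> 'g" and ip0 :: "'g \<Rightarrow> 'g \<Rightarrow> 'k"
    and M :: "'a measure"
    and A \<Psi> B :: "'a \<Rightarrow> 'h \<Rightarrow> 'g"
    and \<kappa> \<beta> \<gamma> :: real
  assumes "hilbert_space_over scl ip"
    and "hilbert_space_over scl0 ip0"
    and "semi_finite_measure M"
    and "continuous_ovf scl ip scl0 ip0 M A \<Psi>"
    and "\<forall>\<alpha>\<in>space M. bounded_operator scl scl0 (B \<alpha>)"
    and "\<forall>\<alpha>\<in>space M. positive_operator ip (\<lambda>h. adjoint_op ip ip0 (\<Psi> \<alpha>) (B \<alpha> h))"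
    and "\<forall>h. strongly_measurable M (\<lambda>\<alpha>. B \<alpha> h)"
    and "0 \<le> \<kappa>" and "0 \<le> \<beta>" and "0 \<le> \<gamma>"
    and "max (\<kappa> + \<gamma> * onorm_L2 M (analysis_op \<Psi> \<circ> inv (frame_op ip ip0 M A \<Psi>))) \<beta> < 1"
    and "\<forall>f\<in>L2 M.
          weakly_integrable ip M (\<lambda>\<alpha>. adjoint_op ip ip0 (A \<alpha>) (f \<alpha>) - adjoint_op ip ip0 (B \<alpha>) (f \<alpha>)) \<and>
          weakly_integrable ip M (\<lambda>\<alpha>. adjoint_op ip ip0 (A \<alpha>) (f \<alpha>)) \<and>
          weakly_integrable ip M (\<lambda>\<alpha>. adjoint_op ip ip0 (B \<alpha>) (f \<alpha>)) \<and>
          norm (weak_integral ip M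
                 (\<lambda>\<alpha>. adjoint_op ip ip0 (A \<alpha>) (f \<alpha>) - adjoint_op ip ip0 (B \<alpha>) (f \<alpha>)))
            \<le> \<kappa> * norm (weak_integral ip M (\<lambda>\<alpha>. adjoint_op ip ip0 (A \<alpha>) (f \<alpha>)))
              + \<beta> * norm (weak_integral ip M (\<lambda>\<alpha>. adjoint_op ip ip0 (B \<alpha>) (f \<alpha>)))
              + \<gamma> * L2_norm M f"
  shows "continuous_ovf scl ip scl0 ip0 M B \<Psi> \<and>
    ((\<exists>h::'h. h \<noteq> 0) \<longrightarrow>
      frame_bounds ip ip0 M B \<Psi>
        ((1 - (\<kappa> + \<gamma> * onorm_L2 M (analysis_op \<Psi> \<circ> inv (frame_op ip ip0 M A \<Psi>)))) / ((1 + \<beta>) * onorm (inv (frame_op ip ip0 M A \<Psi>))))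
        (onorm_L2 M (analysis_op \<Psi>) * ((1 + \<kappa>) * onorm_L2 M (analysis_op A) + \<gamma>) / (1 - \<beta>)))"
proof -
  note H = assms(1) and G = assms(2) and frame = assms(4)
  interpret H: hilbert_space_over scl ip by fact
  interpret G: hilbert_space_over scl0 ip0 by fact
  define S where "S = frame_op ip ip0 M A \<Psi>"
  define R where "R = frame_op ip ip0 M B \<Psi>"
  define VA where "VA f = weak_integral ip M (\<lambda>\<alpha>. adjoint_op ip ip0 (A \<alpha>) (f \<alpha>))" for f
  define VB where "VB f = weak_integral ip M (\<lambda>\<alpha>. adjoint_op ip ip0 (B \<alpha>) (f \<alpha>))" for f
  define lam where "lam = \<kappa> + \<gamma> * onorm_L2 M (analysis_op \<Psi> \<circ> inv S)"
  have lam: "lam < 1" and beta: "\<beta> < 1" using assms(11) by (auto simp: lam_def S_def)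

  have A: "bounded_operator scl scl0 (A \<alpha>)" and Psi: "bounded_operator scl scl0 (\<Psi> \<alpha>)"
    and B: "bounded_operator scl scl0 (B \<alpha>)" if "\<alpha> \<in> space M" for \<alpha>
    using frame assms(5) that by (auto simp: continuous_ovf_def)
  have S_inv: "invertible_operator scl S" and thA: "analysis_op_bounded M A"
    and thPsi: "analysis_op_bounded M \<Psi>"
    using frame by (auto simp: continuous_ovf_def S_def)
  have bl_inv: "bounded_linear (inv S)"
    using S_inv by (auto simp: invertible_operator_def bounded_operator_def)
  have S_left: "inv S (S h) = h" for h
    using S_inv by (auto simp: invertible_operator_def bij_def)
  have Psi_L2: "analysis_op \<Psi> h \<in> L2 M" for h
    using thPsi by (simp add: analysis_op_bounded_def)

  have VA: "has_weak_integral ip M (\<lambda>\<alpha>. adjoint_op ip ip0 (A \<alpha>) (f \<alpha>)) (VA f)"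
    and VB: "has_weak_integral ip M (\<lambda>\<alpha>. adjoint_op ip ip0 (B \<alpha>) (f \<alpha>)) (VB f)"
    if "f \<in> L2 M" for f
    unfolding VA_def VB_def using assms(12) that by (auto intro!: H.has_weak_integral_weak_integral)
  have pert: "norm (VA f - VB f) \<le> \<kappa> * norm (VA f) + \<beta> * norm (VB f) + \<gamma> * L2_norm M f"
    if "f \<in> L2 M" for f
    using assms(12) that H.weak_integral_eqI[OF H.has_weak_integral_diff[OF VA VB], OF that that]
    by (auto simp flip: VA_def VB_def)

  \<comment> \<open>The norm bound for theta_B^*: the triangle inequality and (iii) give (1 -
    \<beta>) norm (VB f) \<le> (1 + \<kappa>) norm (VA f) + \<gamma> \<open>L2_norm M f\<close>, and
    theta_A^* is bounded by the norm of theta_A.\<close>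
  define C where "C = ((1 + \<kappa>) * onorm_L2 M (analysis_op A) + \<gamma>) / (1 - \<beta>)"
  have NA: "0 \<le> onorm_L2 M (analysis_op A)"
    using thA onorm_L2(2)[of M "analysis_op A"] by (auto simp: analysis_op_bounded_def)
  have NPsi: "0 \<le> onorm_L2 M (analysis_op \<Psi>)"
    and NPsi_le: "L2_norm M (analysis_op \<Psi> h) \<le> onorm_L2 M (analysis_op \<Psi>) * norm h" for h
    using thPsi onorm_L2[of M "analysis_op \<Psi>"] by (auto simp: analysis_op_bounded_def)
  have C0: "0 \<le> C" using NA assms(8-10) beta by (simp add: C_def)
  have VB_le: "norm (VB f) \<le> C * L2_norm M f" if f: "f \<in> L2 M" for f
  proof -
    have "norm (VB f) \<le> norm (VA f) + norm (VA f - VB f)"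
      by (metis norm_triangle_sub norm_minus_commute)
    then have "(1 - \<beta>) * norm (VB f) \<le> (1 + \<kappa>) * norm (VA f) + \<gamma> * L2_norm M f"
      using pert[OF f] by (simp add: algebra_simps)
    also have "\<dots> \<le> (1 + \<kappa>) * (onorm_L2 M (analysis_op A) * L2_norm M f) + \<gamma> * L2_norm M f"
      using assms(8) synthesis_op_bounded[OF H G A thA f VA[OF f]]
      by (intro add_right_mono mult_left_mono) auto
    finally show ?thesis using beta by (simp add: C_def field_simps)
  qed
  have thB: "analysis_op_bounded M B"
    using assms(3,7) B VB C0 VB_le by (intro analysis_op_bounded_dual[OF H G, where W = VB]) auto

  have pos: "ip (adjoint_op ip ip0 (\<Psi> \<alpha>) (B \<alpha> x)) y = ip x (adjoint_op ip ip0 (\<Psi> \<alpha>) (B \<alpha> y))"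
    "0 \<le> re_part (ip (adjoint_op ip ip0 (\<Psi> \<alpha>) (B \<alpha> x)) x)" if "\<alpha> \<in> space M" for \<alpha> x y
    using assms(6) that by (auto simp: positive_operator_def)
  \<comment> \<open>Paired with y, the left side is <\<Psi> h, B y> = <h, \<Psi>^* B y>, which the
    self-adjointness contained in hypothesis (i) turns into <\<Psi>^* B h, y>.\<close>
  have adj_swap: "adjoint_op ip ip0 (B \<alpha>) (\<Psi> \<alpha> h) = adjoint_op ip ip0 (\<Psi> \<alpha>) (B \<alpha> h)"
    if "\<alpha> \<in> space M" for \<alpha> h
    using pos(1)[OF that] adjoint_op[OF H G B[OF that]] adjoint_op[OF H G Psi[OF that]]
    by (intro H.eq_if_ip_eq) metis
  have "has_weak_integral ip M (\<lambda>\<alpha>. adjoint_op ip ip0 (\<Psi> \<alpha>) (B \<alpha> h)) (VB (analysis_op \<Psi> h))" for h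
    using VB[OF Psi_L2[of h]] adj_swap
    by (subst (asm) H.has_weak_integral_cong) (auto simp: analysis_op_def)
  moreover from this have R_eq: "R h = VB (analysis_op \<Psi> h)" for h
    unfolding R_def frame_op_def by (intro H.weak_integral_eqI)
  ultimately have R: "has_weak_integral ip M (\<lambda>\<alpha>. adjoint_op ip ip0 (\<Psi> \<alpha>) (B \<alpha> h)) (R h)" for h
    by simp
  have S_eq: "S h = VA (analysis_op \<Psi> h)" for h
    using H.weak_integral_eqI[OF has_weak_integral_frame_op_swap[OF H G frame]]
    by (simp add: S_def VA_def analysis_op_def)

  have R_le: "norm (R h) \<le> onorm_L2 M (analysis_op \<Psi>) * C * norm h" for h
  proof -
    have "norm (R h) \<le> C * (onorm_L2 M (analysis_op \<Psi>) * norm h)"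
      unfolding R_eq using VB_le[OF Psi_L2[of h]] mult_left_mono[OF NPsi_le[of h] C0] by linarith
    then show ?thesis by (simp add: mult_ac)
  qed
  have R_scale: "R (scl c x) = scl c (R x)" for c x
  proof -
    have "has_weak_integral ip M (\<lambda>\<alpha>. adjoint_op ip ip0 (\<Psi> \<alpha>) (B \<alpha> (scl c x))) (scl c (R x))"
    proof (subst H.has_weak_integral_cong)
      show "has_weak_integral ip M (\<lambda>\<alpha>. scl c (adjoint_op ip ip0 (\<Psi> \<alpha>) (B \<alpha> x))) (scl c (R x))"
        by (rule H.has_weak_integral_scale[OF R])
      show "adjoint_op ip ip0 (\<Psi> \<alpha>) (B \<alpha> (scl c x)) = scl c (adjoint_op ip ip0 (\<Psi> \<alpha>) (B \<alpha> x))"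
        if "\<alpha> \<in> space M" for \<alpha>
        \<comment> \<open>Symmetry of the composite exposes its argument as the first argument of
          \<open>ip\<close>, where homogeneity is immediate.\<close>
        using pos(1)[OF that] H.ip_scale_left by (intro H.eq_if_ip_eq) simp
    qed
    then show ?thesis using R H.has_weak_integral_unique by blast
  qed
  have R_add: "R (x + y) = R x + R y" for x y
  proof -
    have "has_weak_integral ip M (\<lambda>\<alpha>. adjoint_op ip ip0 (\<Psi> \<alpha>) (B \<alpha> (x + y))) (R x + R y)"
    proof (subst H.has_weak_integral_cong)
      show "has_weak_integral ip M
          (\<lambda>\<alpha>. adjoint_op ip ip0 (\<Psi> \<alpha>) (B \<alpha> x) + adjoint_op ip ip0 (\<Psi> \<alpha>) (B \<alpha> y)) (R x + R y)"
        by (rule H.has_weak_integral_add[OF R R])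
      show "adjoint_op ip ip0 (\<Psi> \<alpha>) (B \<alpha> (x + y)) =
          adjoint_op ip ip0 (\<Psi> \<alpha>) (B \<alpha> x) + adjoint_op ip ip0 (\<Psi> \<alpha>) (B \<alpha> y)"
        if "\<alpha> \<in> space M" for \<alpha>
        using pos(1)[OF that] H.ip_add_left by (intro H.eq_if_ip_eq) simp
    qed
    then show ?thesis using R H.has_weak_integral_unique by blast
  qed
  have R_bounded: "bounded_operator scl scl R"
    unfolding bounded_operator_def
  proof (intro conjI allI R_scale bounded_linear_intro)
    show "R (r *\<^sub>R x) = r *\<^sub>R R x" for r x
      by (metis R_scale H.scale_of_real)
    show "norm (R x) \<le> norm x * (onorm_L2 M (analysis_op \<Psi>) * C)" for x
      using R_le[of x] by (simp add: mult_ac)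
  qed (rule R_add)
  have R_pos: "positive_operator ip R"
    unfolding positive_operator_def
  proof (intro conjI allI)
    fix x y
    let ?u = "\<lambda>x y \<alpha>. ip (adjoint_op ip ip0 (\<Psi> \<alpha>) (B \<alpha> x)) y"
    have u: "integrable M (?u x y)" "ip (R x) y = (LINT \<alpha>|M. ?u x y \<alpha>)" for x y
      using R[of x] by (auto simp: has_weak_integral_def)
    have "ip (R x) y = (LINT \<alpha>|M. conj (?u y x \<alpha>))"
      unfolding u(2)
    proof (rule Bochner_Integration.integral_cong[OF refl])
      show "?u x y \<alpha> = conj (?u y x \<alpha>)" if "\<alpha> \<in> space M" for \<alpha>
        using pos(1)[OF that, of x y] H.ip_conj by metis
    qed
    also have "\<dots> = conj (ip (R y) x)"
      unfolding u(2) by (rule integral_bounded_linear[OF bounded_linear_conj u(1)])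
    also have "\<dots> = ip x (R y)" by (rule H.ip_conj[symmetric])
    finally show "ip (R x) y = ip x (R y)" .
    have "re_part (ip (R x) x) = (LINT \<alpha>|M. re_part (?u x x \<alpha>))"
      unfolding u(2) by (rule integral_bounded_linear[OF bounded_linear_re_part u(1), symmetric])
    also have "\<dots> \<ge> 0" using pos(2) by (intro Bochner_Integration.integral_nonneg_AE AE_I2)
    finally show "0 \<le> re_part (ip (R x) x)" .
  qed

  \<comment> \<open>The reciprocal of the lower frame bound: (1 - lam) norm (S h) \<le> (1 +
    \<beta>) norm (R h), and h is recovered from S h at the cost of
    \<open>onorm (inv S)\<close>.\<close>
  define K where "K = onorm (inv S) * (1 + \<beta>) / (1 - lam)"
  have below: "norm h \<le> K * norm (R h)" for h
  proof -
    define k where "k = S h"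
    \<comment> \<open>This product bound only certifies that the supremum for the composition is
      finite; the estimate continues with the norm of the composition itself, as in
      \<open>lam\<close>.\<close>
    have "L2_norm M ((analysis_op \<Psi> \<circ> inv S) x)
        \<le> onorm_L2 M (analysis_op \<Psi>) * onorm (inv S) * norm x" for x
      using NPsi_le[of "inv S x"] mult_left_mono[OF onorm[OF bl_inv, of x] NPsi] by simp
    from onorm_L2(1)[OF this, of k]
    have "L2_norm M (analysis_op \<Psi> h) \<le> onorm_L2 M (analysis_op \<Psi> \<circ> inv S) * norm k"
      by (simp add: k_def S_left o_def)
    from mult_left_mono[OF this assms(10)]
    have "norm (k - R h) \<le> lam * norm k + \<beta> * norm (R h)"
      using pert[OF Psi_L2[of h]] by (simp add: k_def S_eq R_eq lam_def algebra_simps)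
    moreover have "norm k \<le> norm (R h) + norm (k - R h)"
      by (metis norm_triangle_sub)
    ultimately have "(1 - lam) * norm k \<le> (1 + \<beta>) * norm (R h)"
      by (simp add: algebra_simps)
    then have "norm k \<le> (1 + \<beta>) * norm (R h) / (1 - lam)"
      using lam by (simp add: field_simps)
    from mult_left_mono[OF this onorm_pos_le[OF bl_inv]]
    have "onorm (inv S) * norm k \<le> K * norm (R h)" by (simp add: K_def)
    moreover have "norm h \<le> onorm (inv S) * norm k"
      using onorm[OF bl_inv, of k] by (simp add: k_def S_left)
    ultimately show ?thesis by linarith
  qed
  note R_inv = H.positive_bounded_below[OF R_bounded R_pos below]

  have "weakly_integrable ip M (\<lambda>\<alpha>. adjoint_op ip ip0 (\<Psi> \<alpha>) (B \<alpha> h))" for h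
    using R weakly_integrable_def by blast
  then have "continuous_ovf scl ip scl0 ip0 M B \<Psi>"
    using B Psi frame assms(7) R_bounded R_pos R_inv(1) thB thPsi
    by (auto simp: continuous_ovf_def R_def)
  moreover have "frame_bounds ip ip0 M B \<Psi> ((1 - lam) / ((1 + \<beta>) * onorm (inv S)))
      (onorm_L2 M (analysis_op \<Psi>) * C)" if ex: "\<exists>h::'h. h \<noteq> 0"
  proof -
    \<comment> \<open>A nonzero vector forces \<open>onorm (inv S)\<close> to be positive. In the
      zero space it would be 0, and the quotient for the lower bound would evaluate to 0.\<close>
    obtain h0 :: 'h where h0: "h0 \<noteq> 0" using ex by blast
    have "onorm (inv S) \<noteq> 0"
      using onorm[OF bl_inv, of "S h0"] h0 unfolding S_left by auto
    then have N: "0 < onorm (inv S)" using onorm_pos_le[OF bl_inv] by simp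
    let ?a = "(1 - lam) / ((1 + \<beta>) * onorm (inv S))" and ?b = "onorm_L2 M (analysis_op \<Psi>) * C"
    have a: "0 < ?a" and aK: "?a * K = 1"
      using lam assms(9) N by (simp_all add: K_def)
    have lower: "?a * (norm h)\<^sup>2 \<le> re_part (ip (R h) h)" for h
      using mult_left_mono[OF R_inv(2)[of h] less_imp_le[OF a]]
      unfolding mult.assoc[symmetric] aK by simp
    have upper: "re_part (ip (R h) h) \<le> ?b * (norm h)\<^sup>2" for h
      using H.re_ip_le[of "R h" h] mult_right_mono[OF R_le[of h], of "norm h"]
      by (simp add: power2_eq_square mult.assoc)
    \<comment> \<open>The factors of \<open>?b\<close> are known only to be nonnegative; strictness
      is inherited from \<open>?a\<close> by comparing both bounds at \<open>h0\<close>.\<close>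
    have "0 < ?a * (norm h0)\<^sup>2" using a h0 by (intro mult_pos_pos) auto
    then have "0 < ?b * (norm h0)\<^sup>2" using lower[of h0] upper[of h0] by linarith
    then have "0 < ?b" using h0 by (intro zero_less_mult_pos2[of ?b "(norm h0)\<^sup>2"]) auto
    then show ?thesis
      unfolding frame_bounds_def R_def[symmetric] using a lower upper by blast
  qed
  ultimately show ?thesis by (simp add: lam_def S_def C_def)
qed

end
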